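(* Let an instance of the zone tariff design problem be given, and let $z^{\ast}_{\mathrm{MA}}$, $z^{\ast}_{\mathrm{MC}}$, $z^{\ast}_{\mathrm{SA}}$, $z^{\ast}_{\mathrm{SC}}$ be the optimal objective function values of the four variants ZD-MA, ZD-MC, ZD-SA, ZD-SC on this instance. Then (with/without requiring the no-elongation property and with/without requiring the no-stopover property, the same choice being made for all four variants): 1. $z^{\ast}_{\mathrm{MA}}\le z^{\ast}_{\mathrm{MC}}$ and $z^{\ast}_{\mathrm{SA}}\le z^{\ast}_{\mathrm{SC}}$. Both may hold strictly, i.e., there is an instance with $z^{\ast}_{\mathrm{MA}}< z^{\ast}_{\mathrm{MC}}$ and there is an instance with $z^{\ast}_{\mathrm{SA}}< z^{\ast}_{\mathrm{SC}}$. 2. $z^{\ast}_{\mathrm{MC}}=z^{\ast}_{\mathrm{SC}}$ if the graph (the PTN) is a tree and the paths $W_d$ for $d\in D$ are the unique simple paths.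
   Context: A public transport network (PTN) $G=(V,E)$ is a finite undirected, connected, simple graph. A path is a finite sequence $(v_1,e_1,v_2,\ldots,e_{n-1},v_n)$ of nodes and edges (repetitions allowed), also written as its node sequence $(v_1,\ldots,v_n)$; it is simple if no edge occurs more than once. $\mathcal{W}$ is the set of all paths, $V(W)$ and $E(W)$ are the set of nodes and the set of edges of $W\in\mathcal{W}$. A fare structure is a function $\pi\colon\mathcal{W}\to\mathbb{R}_{\ge0}$. A zone partition $\mathcal{Z}$ is a partition of $V$ into pairwise disjoint zones with union $V$. The zone function $\sigma$ on paths is, for multiple counting, $\sigma(W)=1+\sum_{e\in E(W)}b(e)$, where $b(\{v_1,v_2\})=0$ if $v_1,v_2$ are in the same zone and $1$ otherwise; and, for single counting, $\sigma(W)=\vert\{Z\in\mathcal{Z}: V(W)\cap Z\neq\emptyset\}\vert$. The zone tariff (with multiple/single counting) w.r.t. $\mathcal{Z}$ and a price function $P\colon\mathbb{N}_{\ge1}\to\mathbb{R}_{\ge0}$ is the fare structure $\pi(W)=P(\sigma(W))$. A fare structure $\pi$ satisfies the no-elongation property if $\pi((v_1,\ldots,v_{n-1}))\le\pi((v_1,\ldots,v_n))$ for all paths $(v_1,\ldots,v_n)\in\mathcal{W}$, $n\ge2$. It satisfies the no-stopover property if $\pi((v_1,\ldots,v_n))\le\pi((v_1,\ldots,v_i))+\pi((v_i,\ldots,v_n))$ for all paths $(v_1,\ldots,v_n)\in\mathcal{W}$, $n\ge3$, and all $i\in\{2,\ldots,n-1\}$. Zone tariff design problem: given a PTN $(V,E)$,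 a set $D\subseteq (V\times V)\setminus\{(v,v):v\in V\}$ of OD (origin-destination) pairs, reference prices $r_d\in\mathbb{R}_{\ge0}$, passenger numbers $t_d\in\mathbb{N}_{\ge1}$ and paths $W_d\in\mathcal{W}$ (from the origin to the destination of $d$) for all $d\in D$, and an upper bound $N\in\mathbb{N}_{\ge1}$ on the number of zones, determine a zone partition $\mathcal{Z}$ with at most $N$ zones and a price function $P$ such that $\sum_{d\in D}t_d\vert r_d-P(\sigma(W_d))\vert$ is minimized. The variants ZD-XY are: X = M for multiple counting, X = S for single counting; Y = A for arbitrary zones (no requirement), Y = C for connected zones, i.e., the induced subgraph $G[Z]$ must be connected for each $Z\in\mathcal{Z}$. "Requiring" a property means that the resulting zone tariff has to satisfy it. *)

theory Defs
  imports Complex_Main "HOL-Library.Disjoint_Sets"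
begin

section \<open>Graphs and paths\<close>

definition simple_graph :: "'v set \<Rightarrow> 'v set set \<Rightarrow> bool" where
  "simple_graph V E \<longleftrightarrow> finite V \<and> (\<forall>e\<in>E. e \<subseteq> V \<and> card e = 2)"

text \<open>In a simple graph a path \<open>(v\<^sub>1, e\<^sub>1, v\<^sub>2, \<dots>, v\<^sub>n)\<close> is determined by its node sequence, so
  paths are nonempty lists of nodes. Repetitions are allowed, and so is \<open>n = 1\<close>.\<close>

definition edge_seq :: "'v list \<Rightarrow> 'v set list" where
  "edge_seq W = map (\<lambda>(u, v). {u, v}) (zip W (tl W))"

definition path_in :: "'v set \<Rightarrow> 'v set set \<Rightarrow> 'v list \<Rightarrow> bool" where
  "path_in V E W \<longleftrightarrow> W \<noteq> [] \<and> set W \<subseteq> V \<and> set (edge_seq W) \<subseteq> E"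

text \<open>Simplicity only forbids repeated edges; nodes may repeat.\<close>

definition simple_path :: "'v set \<Rightarrow> 'v set set \<Rightarrow> 'v list \<Rightarrow> bool" where
  "simple_path V E W \<longleftrightarrow> path_in V E W \<and> distinct (edge_seq W)"

definition connected_graph :: "'v set \<Rightarrow> 'v set set \<Rightarrow> bool" where
  "connected_graph V E \<longleftrightarrow> V \<noteq> {} \<and>
     (\<forall>u\<in>V. \<forall>v\<in>V. \<exists>W. path_in V E W \<and> hd W = u \<and> last W = v)"

definition induced_edges :: "'v set set \<Rightarrow> 'v set \<Rightarrow> 'v set set" where
  "induced_edges E Z = {e \<in> E. e \<subseteq> Z}"

definition PTN :: "'v set \<Rightarrow> 'v set set \<Rightarrow> bool" where
  "PTN V E \<longleftrightarrow> simple_graph V E \<and> connected_graph V E"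

text \<open>A cycle with \<open>k \<ge> 3\<close> nodes is a list of length \<open>k + 1\<close> whose first node is repeated at
  the end.\<close>

definition cycle_in :: "'v set \<Rightarrow> 'v set set \<Rightarrow> 'v list \<Rightarrow> bool" where
  "cycle_in V E W \<longleftrightarrow> path_in V E W \<and> 4 \<le> length W \<and> hd W = last W \<and> distinct (tl W)"

definition tree :: "'v set \<Rightarrow> 'v set set \<Rightarrow> bool" where
  "tree V E \<longleftrightarrow> simple_graph V E \<and> connected_graph V E \<and> (\<nexists>W. cycle_in V E W)"

section \<open>Fare structures and zone tariffs\<close>

text \<open>A fare structure is a function on node lists of which only the values on paths matter.\<close>

definition no_elongation :: "'v set \<Rightarrow> 'v set set \<Rightarrow> ('v list \<Rightarrow> real) \<Rightarrow> bool" where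
  "no_elongation V E \<pi> \<longleftrightarrow>
     (\<forall>W. path_in V E W \<and> 2 \<le> length W \<longrightarrow> \<pi> (butlast W) \<le> \<pi> W)"

text \<open>With 1-based indices, \<open>take i W\<close> is \<open>(v\<^sub>1, \<dots>, v\<^sub>i)\<close> and \<open>drop (i - 1) W\<close> is
  \<open>(v\<^sub>i, \<dots>, v\<^sub>n)\<close>.\<close>

definition no_stopover :: "'v set \<Rightarrow> 'v set set \<Rightarrow> ('v list \<Rightarrow> real) \<Rightarrow> bool" where
  "no_stopover V E \<pi> \<longleftrightarrow>
     (\<forall>W. path_in V E W \<and> 3 \<le> length W \<longrightarrow>
        (\<forall>i\<in>{2..length W - 1}. \<pi> W \<le> \<pi> (take i W) + \<pi> (drop (i - 1) W)))"

definition border :: "'v set set \<Rightarrow> 'v set \<Rightarrow> nat" where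
  "border \<Z> e = (if \<exists>Z\<in>\<Z>. e \<subseteq> Z then 0 else 1)"

datatype counting = Multiple | Single

text \<open>For multiple counting the sum ranges over the \<^emph>\<open>set\<close> of edges of the path, so an edge that
  is traversed repeatedly contributes once.\<close>

fun zone_count :: "counting \<Rightarrow> 'v set set \<Rightarrow> 'v list \<Rightarrow> nat" where
  "zone_count Multiple \<Z> W = 1 + (\<Sum>e\<in>set (edge_seq W). border \<Z> e)"
| "zone_count Single \<Z> W = card {Z \<in> \<Z>. set W \<inter> Z \<noteq> {}}"

definition zone_tariff :: "counting \<Rightarrow> 'v set set \<Rightarrow> (nat \<Rightarrow> real) \<Rightarrow> 'v list \<Rightarrow> real" where
  "zone_tariff c \<Z> P W = P (zone_count c \<Z> W)"

section \<open>The zone tariff design problem\<close>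

record 'v zd_instance =
  nodes :: "'v set"
  edges :: "'v set set"
  od_pairs :: "('v \<times> 'v) set"
  ref_price :: "'v \<times> 'v \<Rightarrow> real"
  passengers :: "'v \<times> 'v \<Rightarrow> nat"
  od_path :: "'v \<times> 'v \<Rightarrow> 'v list"
  max_zones :: nat

definition valid_instance :: "'v zd_instance \<Rightarrow> bool" where
  "valid_instance I \<longleftrightarrow>
     PTN (nodes I) (edges I) \<and>
     od_pairs I \<subseteq> nodes I \<times> nodes I - {(v, v) |v. v \<in> nodes I} \<and>
     (\<forall>d\<in>od_pairs I.
        0 \<le> ref_price I d \<and> 1 \<le> passengers I d \<and>
        path_in (nodes I) (edges I) (od_path I d) \<and>
        hd (od_path I d) = fst d \<and> last (od_path I d) = snd d) \<and>
     1 \<le> max_zones I"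

datatype zone_shape = Arbitrary | Connected

text \<open>The flags \<open>ne\<close> and \<open>ns\<close> tell whether the no-elongation and the no-stopover property are
  required. Price functions have domain \<open>{1..}\<close>; the value \<open>P 0\<close> is never used, since zone counts
  of paths are positive.\<close>

definition feasible ::
  "counting \<Rightarrow> zone_shape \<Rightarrow> bool \<Rightarrow> bool \<Rightarrow> 'v zd_instance \<Rightarrow> ('v set set \<times> (nat \<Rightarrow> real)) set" where
  "feasible c s ne ns I = {(\<Z>, P).
     partition_on (nodes I) \<Z> \<and> card \<Z> \<le> max_zones I \<and>
     (\<forall>n\<ge>1. 0 \<le> P n) \<and>
     (s = Connected \<longrightarrow> (\<forall>Z\<in>\<Z>. connected_graph Z (induced_edges (edges I) Z))) \<and>
     (ne \<longrightarrow> no_elongation (nodes I) (edges I) (zone_tariff c \<Z> P)) \<and>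
     (ns \<longrightarrow> no_stopover (nodes I) (edges I) (zone_tariff c \<Z> P))}"

definition objective :: "counting \<Rightarrow> 'v zd_instance \<Rightarrow> 'v set set \<times> (nat \<Rightarrow> real) \<Rightarrow> real" where
  "objective c I = (\<lambda>(\<Z>, P).
     \<Sum>d\<in>od_pairs I. real (passengers I d) * \<bar>ref_price I d - zone_tariff c \<Z> P (od_path I d)\<bar>)"

definition opt_value :: "counting \<Rightarrow> zone_shape \<Rightarrow> bool \<Rightarrow> bool \<Rightarrow> 'v zd_instance \<Rightarrow> real" where
  "opt_value c s ne ns I = Inf (objective c I ` feasible c s ne ns I)"

text \<open>The infimum is taken over a nonempty set that is bounded below, so it is meaningful for every
  valid instance.\<close>

lemma objective_nonneg: "0 \<le> objective c I x"
  by (auto simp: objective_def split: prod.split intro!: sum_nonneg)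

lemma bdd_below_objective: "bdd_below (objective c I ` A)"
  by (rule bdd_belowI2[where m = 0]) (rule objective_nonneg)

lemma feasible_nonempty:
  assumes "valid_instance I"
  shows "feasible c s ne ns I \<noteq> {}"
proof -
  have G: "simple_graph (nodes I) (edges I)" "connected_graph (nodes I) (edges I)"
    and N: "1 \<le> max_zones I"
    using assms by (auto simp: valid_instance_def PTN_def)
  have "induced_edges (edges I) (nodes I) = edges I"
    using G(1) by (auto simp: induced_edges_def simple_graph_def)
  moreover have "partition_on (nodes I) {nodes I}"
    using G(2) by (auto simp: partition_on_def connected_graph_def)
  ultimately have "({nodes I}, \<lambda>_. 0) \<in> feasible c s ne ns I"
    using G N
    by (auto simp: feasible_def no_elongation_def no_stopover_def zone_tariff_def)
  then show ?thesis by blast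
qed

end

theory Submission
  imports Defs
begin

text \<open>
  The inequalities hold because requiring connected zones only shrinks the feasible set. That they
  can be strict is witnessed, for both ways of counting and all choices of required properties at
  once, by the line \<open>0 - 1 - 2 - 3\<close> with at most two zones and the reference prices \<open>2\<close>, \<open>1\<close>, \<open>2\<close>
  for the paths \<open>(0, 1)\<close>, \<open>(2, 3)\<close>, \<open>(1, 2, 3)\<close>. The zones \<open>{0, 2, 3}\<close> and \<open>{1}\<close> reproduce these
  prices exactly. Two connected zones leave at most one border on the line, and wherever it lies,
  \<open>(2, 3)\<close> has the same zone count as one of the paths that should cost twice as much, so the
  deviation is at least \<open>1\<close>.

  On a tree with connected zones, the two ways of counting agree on every path, even if it repeats
  edges (\<open>zone_count_Multiple_eq_Single\<close>). Indeed, extend a path by one edge: if the edge is a new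
  border edge, then it enters a zone not visited so far. Otherwise one could walk back along the
  path to the earlier visit and then inside the connected zone to the new node, and this walk
  avoids the new edge, which would thus lie on a cycle. Hence each distinct border edge of a path
  accounts for exactly one further zone. As the two zone tariffs agree on all paths, so do the
  no-elongation and no-stopover properties, and ZD-MC and ZD-SC are the same problem.
\<close>

section \<open>Paths and reachability\<close>

lemma edge_seq_simps [simp]:
  "edge_seq [] = []"
  "edge_seq [v] = []"
  "edge_seq (v # u # W) = {v, u} # edge_seq (u # W)"
  by (simp_all add: edge_seq_def)

lemma edge_seq_subset: "e \<in> set (edge_seq W) \<Longrightarrow> e \<subseteq> set W"
  by (induction W rule: induct_list012) auto

lemma path_in_simps [simp]:
  "\<not> path_in V E []"
  "path_in V E [v] \<longleftrightarrow> v \<in> V"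
  "path_in V E (v # u # W) \<longleftrightarrow> v \<in> V \<and> {v, u} \<in> E \<and> path_in V E (u # W)"
  by (auto simp: path_in_def)

lemma path_in_mono: "path_in V E W \<Longrightarrow> V \<subseteq> V' \<Longrightarrow> E \<subseteq> E' \<Longrightarrow> path_in V' E' W"
  by (auto simp: path_in_def)

lemma path_in_appendD: "path_in V E (xs @ ys) \<Longrightarrow> ys \<noteq> [] \<Longrightarrow> path_in V E ys"
proof (induction xs)
  case (Cons x xs)
  then show ?case by (cases "xs @ ys") auto
qed simp

lemma edge_seq_take: "edge_seq (take n W) = take (n - 1) (edge_seq W)"
proof (induction W arbitrary: n rule: induct_list012)
  case (3 v u W)
  show ?case
    using 3(2)[of "n - 1"] by (cases n; cases "n - 1") auto
qed (auto simp: take_Cons split: nat.splits)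

lemma path_in_take: "path_in V E W \<Longrightarrow> 0 < n \<Longrightarrow> path_in V E (take n W)"
  unfolding path_in_def edge_seq_take by (auto dest: in_set_takeD)

lemma path_in_drop: "path_in V E W \<Longrightarrow> n < length W \<Longrightarrow> path_in V E (drop n W)"
  using path_in_appendD[of V E "take n W" "drop n W"] by simp

definition adjacent :: "'v set set \<Rightarrow> ('v \<times> 'v) set" where
  "adjacent F = {(x, y). {x, y} \<in> F}"

lemma adjacent_mono: "F \<subseteq> F' \<Longrightarrow> adjacent F \<subseteq> adjacent F'"
  by (auto simp: adjacent_def)

lemma reachable_mono: "(x, y) \<in> (adjacent F)\<^sup>* \<Longrightarrow> F \<subseteq> F' \<Longrightarrow> (x, y) \<in> (adjacent F')\<^sup>*"
  using rtrancl_mono[OF adjacent_mono] by blast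

lemma reachable_along_path:
  "w \<in> set W \<Longrightarrow> (hd W, w) \<in> (adjacent (set (edge_seq W)))\<^sup>*"
proof (induction W rule: induct_list012)
  case (3 v u W)
  show ?case
  proof (cases "w = v")
    case False
    then have "(u, w) \<in> (adjacent (set (edge_seq (u # W))))\<^sup>*"
      using 3 by simp
    then have "(u, w) \<in> (adjacent (set (edge_seq (v # u # W))))\<^sup>*"
      by (rule reachable_mono) auto
    then show ?thesis
      by (auto simp: adjacent_def intro: converse_rtrancl_into_rtrancl)
  qed simp
qed auto

lemma connected_graph_reachable:
  assumes "connected_graph Z F" "x \<in> Z" "y \<in> Z"
  shows "(x, y) \<in> (adjacent F)\<^sup>*"
proof -
  obtain W where W: "path_in Z F W" "hd W = x" "last W = y"
    using assms by (auto simp: connected_graph_def)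
  then have "(x, y) \<in> (adjacent (set (edge_seq W)))\<^sup>*"
    using reachable_along_path[of y W] by (auto simp: path_in_def)
  then show ?thesis
    using W(1) by (auto simp: path_in_def intro: reachable_mono)
qed

lemma reachable_imp_distinct_path:
  assumes "(x, y) \<in> (adjacent F)\<^sup>*" "y \<in> V" "\<Union>F \<subseteq> V"
  shows "\<exists>W. path_in V F W \<and> distinct W \<and> hd W = x \<and> last W = y"
  using assms(1)
proof (induction rule: converse_rtrancl_induct)
  case base
  have "path_in V F [y] \<and> distinct [y] \<and> hd [y] = y \<and> last [y] = y"
    using assms by simp
  then show ?case by blast
next
  case (step x z)
  then obtain W where W: "path_in V F W" "distinct W" "hd W = z" "last W = y"
    by blast
  have xz: "{x, z} \<in> F" and "x \<in> V"
    using step assms by (auto simp: adjacent_def)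
  show ?case
  proof (cases "x \<in> set W")
    case True
    then obtain ys zs where "W = ys @ x # zs"
      by (auto simp: in_set_conv_decomp)
    then have "path_in V F (x # zs) \<and> distinct (x # zs) \<and> hd (x # zs) = x \<and> last (x # zs) = y"
      using W path_in_appendD[of V F ys "x # zs"] by auto
    then show ?thesis by blast
  next
    case False
    obtain W' where "W = z # W'"
      using W by (cases W) auto
    then have "path_in V F (x # W) \<and> distinct (x # W) \<and> hd (x # W) = x \<and> last (x # W) = y"
      using W xz False \<open>x \<in> V\<close> by auto
    then show ?thesis by blast
  qed
qed

text \<open>A walk from \<open>u\<close> to \<open>v\<close> avoiding the edge \<open>{u, v}\<close> can be shortened to one without repeated
  nodes; the edge closes it to a cycle.\<close>

lemma tree_edge_is_bridge:
  assumes "tree V E" "{u, v} \<in> E"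
  shows "(u, v) \<notin> (adjacent (E - {{u, v}}))\<^sup>*"
proof
  assume *: "(u, v) \<in> (adjacent (E - {{u, v}}))\<^sup>*"
  have E: "\<forall>e\<in>E. e \<subseteq> V \<and> card e = 2"
    using assms by (auto simp: tree_def simple_graph_def)
  have "card {u, v} = 2" "{u, v} \<subseteq> V"
    using E assms(2) by blast+
  then have uv: "u \<noteq> v" "v \<in> V"
    by auto
  obtain W where W: "path_in V (E - {{u, v}}) W" "distinct W" "hd W = u" "last W = v"
    using reachable_imp_distinct_path[OF *, of V] E uv by blast
  then obtain W' where W': "W = u # W'" by (cases W) auto
  \<comment> \<open>The path has an inner node: \<open>(u, v)\<close> itself would use the forbidden edge.\<close>
  obtain x y W'' where W'': "W = u # x # y # W''"
  proof (cases W')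
    case (Cons x X)
    then show ?thesis
      using W W' uv that by (cases X) auto
  qed (use W W' uv in auto)
  have "path_in V E W"
    using W(1) by (rule path_in_mono) auto
  then have "cycle_in V E (v # W)"
    using W W'' uv assms(2) by (auto simp: cycle_in_def insert_commute)
  then show False
    using assms(1) by (auto simp: tree_def)
qed

section \<open>Counting zones\<close>

lemma partition_on_zone_unique:
  "partition_on V \<Z> \<Longrightarrow> Z \<in> \<Z> \<Longrightarrow> Z' \<in> \<Z> \<Longrightarrow> v \<in> Z \<Longrightarrow> v \<in> Z' \<Longrightarrow> Z = Z'"
  by (auto simp: partition_on_def disjoint_def)

lemma zones_visited_insert:
  assumes "partition_on V \<Z>" "Z \<in> \<Z>" "v \<in> Z"
  shows "{Y \<in> \<Z>. insert v A \<inter> Y \<noteq> {}} = insert Z {Y \<in> \<Z>. A \<inter> Y \<noteq> {}}"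
  using assms partition_on_zone_unique[OF assms(1)] by auto

lemma zone_count_singleton:
  assumes "partition_on V \<Z>" "v \<in> V"
  shows "zone_count c \<Z> [v] = 1"
proof -
  obtain Z where "Z \<in> \<Z>" "v \<in> Z"
    using assms by (auto simp: partition_on_def)
  then show ?thesis
    using zones_visited_insert[OF assms(1), of Z v "{}"] by (cases c) auto
qed

lemma zone_count_Cons_same_zone:
  assumes "partition_on V \<Z>" "Z \<in> \<Z>" "v \<in> Z" "u \<in> Z"
  shows "zone_count c \<Z> (v # u # W) = zone_count c \<Z> (u # W)"
proof (cases c)
  case Multiple
  have "border \<Z> {v, u} = 0"
    using assms by (auto simp: border_def)
  then have "(\<Sum>e\<in>set (edge_seq (v # u # W)). border \<Z> e) = (\<Sum>e\<in>set (edge_seq (u # W)). border \<Z> e)"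
    by (simp add: sum.insert_if)
  then show ?thesis
    using Multiple by simp
next
  case Single
  have "{Y \<in> \<Z>. set (v # u # W) \<inter> Y \<noteq> {}} = {Y \<in> \<Z>. set (u # W) \<inter> Y \<noteq> {}}"
    using zones_visited_insert[OF assms(1-3), of "set (u # W)"] assms by auto
  then show ?thesis
    using Single by simp
qed

text \<open>The path is extended at its front, which is harmless because the graph is undirected.\<close>

lemma zone_count_Multiple_eq_Single:
  assumes tree: "tree V E" and part: "partition_on V \<Z>"
    and conn: "\<forall>Z\<in>\<Z>. connected_graph Z (induced_edges E Z)"
    and "path_in V E W"
  shows "zone_count Multiple \<Z> W = zone_count Single \<Z> W"
  using assms(4)
proof (induction W rule: induct_list012)
  case (2 v)
  then show ?case
    using zone_count_singleton[OF part, of v Multiple] zone_count_singleton[OF part, of v Single]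
    by simp
next
  case (3 v u W)
  let ?W = "u # W"
  have IH: "zone_count Multiple \<Z> ?W = zone_count Single \<Z> ?W"
    and W: "set (edge_seq ?W) \<subseteq> E" and vu: "{v, u} \<in> E" and "v \<in> V"
    using 3 by (auto simp: path_in_def)
  obtain Z where Z: "Z \<in> \<Z>" "v \<in> Z"
    using part \<open>v \<in> V\<close> by (auto simp: partition_on_def)
  have visited: "{Y \<in> \<Z>. set (v # ?W) \<inter> Y \<noteq> {}} = insert Z {Y \<in> \<Z>. set ?W \<inter> Y \<noteq> {}}"
    using zones_visited_insert[OF part Z, of "set ?W"] by simp
  have fin: "finite \<Z>"
    using part tree finite_elements by (auto simp: tree_def simple_graph_def)
  consider "u \<in> Z" | "{v, u} \<in> set (edge_seq ?W)" | "u \<notin> Z" "{v, u} \<notin> set (edge_seq ?W)"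
    by blast
  then show ?case
  proof cases
    case 1
    then show ?thesis
      using zone_count_Cons_same_zone[OF part Z] IH by metis
  next
    case 2
    have "v \<in> set ?W"
      using edge_seq_subset[OF 2] by simp
    then have "set (v # ?W) = set ?W"
      by auto
    moreover have "set (edge_seq (v # ?W)) = set (edge_seq ?W)"
      using 2 by auto
    ultimately show ?thesis
      using IH by (simp only: zone_count.simps)
  next
    case 3
    have "set ?W \<inter> Z = {}"
    proof (rule ccontr)
      assume "set ?W \<inter> Z \<noteq> {}"
      then obtain w where w: "w \<in> set ?W" "w \<in> Z"
        by blast
      have "(u, w) \<in> (adjacent (set (edge_seq ?W)))\<^sup>*"
        using reachable_along_path[OF w(1)] by simp
      then have "(u, w) \<in> (adjacent (E - {{u, v}}))\<^sup>*"
        by (rule reachable_mono) (use W 3 in \<open>auto simp: insert_commute\<close>)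
      moreover have "(w, v) \<in> (adjacent (induced_edges E Z))\<^sup>*"
        using connected_graph_reachable conn Z w by metis
      then have "(w, v) \<in> (adjacent (E - {{u, v}}))\<^sup>*"
        by (rule reachable_mono) (use 3 in \<open>auto simp: induced_edges_def\<close>)
      ultimately have "(u, v) \<in> (adjacent (E - {{u, v}}))\<^sup>*"
        by (rule rtrancl_trans)
      then show False
        using tree_edge_is_bridge[OF tree, of u v] vu by (simp add: insert_commute)
    qed
    then have "zone_count Single \<Z> (v # ?W) = Suc (zone_count Single \<Z> ?W)"
      using visited fin by simp
    moreover have "border \<Z> {v, u} = 1"
      using partition_on_zone_unique[OF part _ Z(1) _ Z(2)] 3 by (auto simp: border_def)
    then have "zone_count Multiple \<Z> (v # ?W) = Suc (zone_count Multiple \<Z> ?W)"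
      using 3 by (simp add: sum.insert_if)
    ultimately show ?thesis
      using IH by simp
  qed
qed simp

section \<open>Connected zones on trees\<close>

text \<open>Both properties compare the fare of a path only with fares of subpaths, which are paths
  themselves.\<close>

lemma no_elongation_cong:
  assumes "\<And>W. path_in V E W \<Longrightarrow> f W = g W"
  shows "no_elongation V E f \<longleftrightarrow> no_elongation V E g"
proof -
  have "f W = g W" "f (butlast W) = g (butlast W)" if "path_in V E W" "2 \<le> length W" for W
    using that assms path_in_take[OF that(1), of "length W - 1"] by (auto simp: butlast_conv_take)
  then show ?thesis
    by (simp add: no_elongation_def cong: conj_cong)
qed

lemma no_stopover_cong:
  assumes "\<And>W. path_in V E W \<Longrightarrow> f W = g W"
  shows "no_stopover V E f \<longleftrightarrow> no_stopover V E g"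
proof -
  have "f W = g W" "f (take i W) = g (take i W)" "f (drop (i - 1) W) = g (drop (i - 1) W)"
    if "path_in V E W" "i \<in> {2..length W - 1}" for W i
    using that by (auto intro!: assms path_in_take path_in_drop)
  then show ?thesis
    unfolding no_stopover_def by (metis (no_types, lifting))
qed

lemma opt_value_Multiple_eq_Single:
  assumes "valid_instance I" "tree (nodes I) (edges I)"
  shows "opt_value Multiple Connected ne ns I = opt_value Single Connected ne ns I"
proof -
  have tariff: "zone_tariff Multiple \<Z> P W = zone_tariff Single \<Z> P W"
    if "partition_on (nodes I) \<Z>" "\<forall>Z\<in>\<Z>. connected_graph Z (induced_edges (edges I) Z)"
      "path_in (nodes I) (edges I) W" for \<Z> P W
    using zone_count_Multiple_eq_Single[OF assms(2) that] by (simp only: zone_tariff_def)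
  have "no_elongation (nodes I) (edges I) (zone_tariff Multiple \<Z> P) \<longleftrightarrow>
        no_elongation (nodes I) (edges I) (zone_tariff Single \<Z> P)"
    "no_stopover (nodes I) (edges I) (zone_tariff Multiple \<Z> P) \<longleftrightarrow>
        no_stopover (nodes I) (edges I) (zone_tariff Single \<Z> P)"
    if "partition_on (nodes I) \<Z>" "\<forall>Z\<in>\<Z>. connected_graph Z (induced_edges (edges I) Z)" for \<Z> P
    using tariff[OF that] no_elongation_cong no_stopover_cong by blast+
  then have "feasible Multiple Connected ne ns I = feasible Single Connected ne ns I"
    unfolding feasible_def by auto
  moreover have "objective Multiple I x = objective Single I x"
    if x: "x \<in> feasible Single Connected ne ns I" for x
  proof -
    have "\<forall>d\<in>od_pairs I. path_in (nodes I) (edges I) (od_path I d)"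
      using assms(1) by (simp add: valid_instance_def)
    then show ?thesis
      using x tariff by (auto simp: objective_def feasible_def intro!: sum.cong)
  qed
  ultimately show ?thesis
    by (simp add: opt_value_def)
qed

section \<open>Arbitrary versus connected zones\<close>

lemma opt_value_Arbitrary_le_Connected:
  assumes "valid_instance I"
  shows "opt_value c Arbitrary ne ns I \<le> opt_value c Connected ne ns I"
  unfolding opt_value_def
proof (rule cInf_superset_mono)
  show "objective c I ` feasible c Connected ne ns I \<noteq> {}"
    using feasible_nonempty[OF assms] by blast
  show "objective c I ` feasible c Connected ne ns I \<subseteq> objective c I ` feasible c Arbitrary ne ns I"
    by (rule image_mono) (auto simp: feasible_def)
qed (rule bdd_below_objective)

text \<open>Two sufficient conditions on the price function alone. They let a single tariff settle all
  combinations of required properties: shortening a path cannot raise its zone count, and if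
  all prices lie between \<open>m\<close> and \<open>2 m\<close>, then no single ticket costs more than two tickets.\<close>

lemma no_elongation_mono_price:
  assumes "mono P" "finite \<Z>"
  shows "no_elongation V E (zone_tariff c \<Z> P)"
proof -
  have "zone_count c \<Z> (butlast W) \<le> zone_count c \<Z> W" for W
  proof (cases c)
    case Multiple
    have "set (edge_seq (butlast W)) \<subseteq> set (edge_seq W)"
      by (auto simp: butlast_conv_take edge_seq_take dest: in_set_takeD)
    then show ?thesis
      using Multiple by (simp add: sum_mono2)
  next
    case Single
    have "{Z \<in> \<Z>. set (butlast W) \<inter> Z \<noteq> {}} \<subseteq> {Z \<in> \<Z>. set W \<inter> Z \<noteq> {}}"
      by (auto dest: in_set_butlastD)
    then show ?thesis
      using Single assms(2) by (simp add: card_mono)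
  qed
  then show ?thesis
    using monoD[OF assms(1)] by (simp add: no_elongation_def zone_tariff_def)
qed

lemma no_stopover_bounded_price:
  assumes "\<And>n. m \<le> P n" "\<And>n. P n \<le> 2 * m"
  shows "no_stopover V E (zone_tariff c \<Z> P)"
proof -
  have "P k \<le> P i + P j" for i j k
    using assms(1)[of i] assms(1)[of j] assms(2)[of k] by linarith
  then show ?thesis
    by (simp add: no_stopover_def zone_tariff_def)
qed

definition line_instance :: "nat zd_instance" where
  "line_instance = \<lparr>
     nodes = {0, 1, 2, 3},
     edges = {{0, 1}, {1, 2}, {2, 3}},
     od_pairs = {(0, 1), (2, 3), (1, 3)},
     ref_price = (\<lambda>d. if d = (2, 3) then 1 else 2),
     passengers = (\<lambda>_. 1),
     od_path = (\<lambda>d. if d = (0, 1) then [0, 1] else if d = (2, 3) then [2, 3] else [1, 2, 3]),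
     max_zones = 2\<rparr>"

lemma valid_line_instance: "valid_instance line_instance"
proof -
  let ?V = "{0, 1, 2, 3} :: nat set" and ?E = "{{0, 1}, {1, 2}, {2, 3}} :: nat set set"
  have "simple_graph ?V ?E"
    by (simp add: simple_graph_def)
  moreover have "\<exists>W. path_in ?V ?E W \<and> hd W = u \<and> last W = v" if "u \<in> ?V" "v \<in> ?V" for u v
  proof -
    define W :: "nat list" where "W = (if u \<le> v then drop u (take (Suc v) [0, 1, 2, 3])
      else drop (3 - u) (take (4 - v) [3, 2, 1, 0]))"
    have "path_in ?V ?E W \<and> hd W = u \<and> last W = v"
      using that unfolding W_def by (auto simp: doubleton_eq_iff)
    then show ?thesis by blast
  qed
  ultimately show ?thesis
    by (auto simp: line_instance_def valid_instance_def PTN_def connected_graph_def)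
qed

lemma opt_value_line_Arbitrary: "opt_value c Arbitrary ne ns line_instance \<le> 0"
proof -
  let ?\<Z> = "{{0, 2, 3}, {1}} :: nat set set"
  let ?P = "\<lambda>n :: nat. if n \<le> 1 then 1 else 2 :: real"
  have "no_elongation V E (zone_tariff c ?\<Z> ?P)" for V E
    by (rule no_elongation_mono_price) (auto simp: mono_def)
  moreover have "no_stopover V E (zone_tariff c ?\<Z> ?P)" for V E
    by (rule no_stopover_bounded_price[where m = 1]) auto
  moreover have "partition_on {0, 1, 2, 3} ?\<Z>"
    by (auto simp: partition_on_def disjoint_def)
  ultimately have "(?\<Z>, ?P) \<in> feasible c Arbitrary ne ns line_instance"
    by (auto simp: feasible_def line_instance_def)
  moreover have "objective c line_instance (?\<Z>, ?P) = 0"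
  proof -
    have S: "{Z \<in> ?\<Z>. {0, 1} \<inter> Z \<noteq> {}} = ?\<Z>" "{Z \<in> ?\<Z>. {2, 3} \<inter> Z \<noteq> {}} = {{0, 2, 3}}"
      "{Z \<in> ?\<Z>. {1, 2, 3} \<inter> Z \<noteq> {}} = ?\<Z>"
      by auto
    have "zone_count c ?\<Z> [0, 1] = 2" "zone_count c ?\<Z> [2, 3] = 1" "zone_count c ?\<Z> [1, 2, 3] = 2"
      using S by (cases c; simp add: border_def doubleton_eq_iff)+
    then show ?thesis
      by (simp add: objective_def line_instance_def zone_tariff_def)
  qed
  ultimately have "0 \<in> objective c line_instance ` feasible c Arbitrary ne ns line_instance"
    by (intro image_eqI[where x = "(?\<Z>, ?P)"]) (rule sym)
  then show ?thesis
    unfolding opt_value_def by (rule cInf_lower) (rule bdd_below_objective)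
qed

lemma connected_graph_neighbour:
  assumes "connected_graph Z F" "x \<in> Z" "y \<in> Z" "x \<noteq> y"
  shows "\<exists>z\<in>Z. {x, z} \<in> F"
proof -
  obtain W where W: "path_in Z F W" "hd W = x" "last W = y"
    using assms by (auto simp: connected_graph_def)
  obtain z W' where "W = x # z # W'"
    using W assms(4) by (cases W; cases "tl W") auto
  then show ?thesis
    using W(1) by (auto simp: path_in_def)
qed

lemma opt_value_line_Connected: "1 \<le> opt_value c Connected ne ns line_instance"
proof -
  have "1 \<le> objective c line_instance (\<Z>, P)"
    if "(\<Z>, P) \<in> feasible c Connected ne ns line_instance" for \<Z> P
  proof -
    let ?E = "{{0, 1}, {1, 2}, {2, 3}} :: nat set set"
    have part: "partition_on {0, 1, 2, 3} \<Z>" and card: "card \<Z> \<le> 2"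
      and conn: "\<And>Z. Z \<in> \<Z> \<Longrightarrow> connected_graph Z (induced_edges ?E Z)"
      using that by (auto simp: feasible_def line_instance_def)
    have "finite \<Z>"
      using finite_elements[OF _ part] by simp
    have "\<Union>\<Z> = {0, 1, 2, 3}"
      using part by (simp add: partition_on_def)
    then have "1 \<in> \<Union>\<Z>" "2 \<in> \<Union>\<Z>"
      by simp_all
    then obtain Z\<^sub>1 Z\<^sub>2 where Z: "Z\<^sub>1 \<in> \<Z>" "1 \<in> Z\<^sub>1" "Z\<^sub>2 \<in> \<Z>" "2 \<in> Z\<^sub>2"
      by blast
    \<comment> \<open>If \<open>1\<close> and \<open>2\<close> share a zone, then starting at \<open>1\<close> instead of \<open>2\<close> is free. Otherwise the only
      border is \<open>{1, 2}\<close>, and the paths \<open>(0, 1)\<close> and \<open>(2, 3)\<close> each stay within one zone.\<close>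
    have "zone_count c \<Z> [1, 2, 3] = zone_count c \<Z> [2, 3] \<or>
          zone_count c \<Z> [0, 1] = zone_count c \<Z> [2, 3]"
    proof (cases "Z\<^sub>1 = Z\<^sub>2")
      case True
      then show ?thesis
        using zone_count_Cons_same_zone[OF part Z(1,2), of 2 c "[3]"] Z by simp
    next
      case False
      have disj: "2 \<notin> Z\<^sub>1" "1 \<notin> Z\<^sub>2"
        using False Z partition_on_zone_unique[OF part] by blast+
      have "\<Z> = {Z\<^sub>1, Z\<^sub>2}"
        using card_seteq[OF \<open>finite \<Z>\<close>, of "{Z\<^sub>1, Z\<^sub>2}"] Z card False by simp
      then have "Z\<^sub>1 \<union> Z\<^sub>2 = {0, 1, 2, 3}"
        using \<open>\<Union>\<Z> = _\<close> by simp
      \<comment> \<open>The only neighbour of \<open>0\<close> is \<open>1\<close>, and the only neighbour of \<open>3\<close> is \<open>2\<close>.\<close>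
      moreover have "0 \<notin> Z\<^sub>2"
        using connected_graph_neighbour[OF conn[OF Z(3)], of 0 2] Z disj
        by (auto simp: induced_edges_def doubleton_eq_iff)
      moreover have "3 \<notin> Z\<^sub>1"
        using connected_graph_neighbour[OF conn[OF Z(1)], of 3 1] Z disj
        by (auto simp: induced_edges_def doubleton_eq_iff)
      ultimately have "0 \<in> Z\<^sub>1" "3 \<in> Z\<^sub>2"
        by blast+
      then have "zone_count c \<Z> [0, 1] = zone_count c \<Z> [1]"
        "zone_count c \<Z> [2, 3] = zone_count c \<Z> [3]"
        using zone_count_Cons_same_zone[OF part Z(1), of 0 1 c "[]"]
          zone_count_Cons_same_zone[OF part Z(3), of 2 3 c "[]"] Z by simp_all
      then show ?thesis
        using zone_count_singleton[OF part] by simp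
    qed
    moreover have "objective c line_instance (\<Z>, P) =
        \<bar>2 - P (zone_count c \<Z> [0, 1])\<bar> + \<bar>1 - P (zone_count c \<Z> [2, 3])\<bar> +
        \<bar>2 - P (zone_count c \<Z> [1, 2, 3])\<bar>"
      by (simp add: objective_def line_instance_def zone_tariff_def)
    moreover have "1 \<le> \<bar>2 - p\<bar> + \<bar>1 - p\<bar>" for p :: real
      by (simp add: abs_if)
    ultimately show ?thesis
      by (elim disjE) (smt (verit))+
  qed
  then show ?thesis
    unfolding opt_value_def
    using feasible_nonempty[OF valid_line_instance] by (intro cInf_greatest) auto
qed

section \<open>Comparison of the optimal values\<close>

theorem lemma18:
  fixes ne ns :: bool
  shows
    "(\<forall>I :: 'v zd_instance. valid_instance I \<longrightarrow>
        opt_value Multiple Arbitrary ne ns I \<le> opt_value Multiple Connected ne ns I \<and>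
        opt_value Single Arbitrary ne ns I \<le> opt_value Single Connected ne ns I) \<and>
     (\<exists>I :: nat zd_instance. valid_instance I \<and>
        opt_value Multiple Arbitrary ne ns I < opt_value Multiple Connected ne ns I) \<and>
     (\<exists>I :: nat zd_instance. valid_instance I \<and>
        opt_value Single Arbitrary ne ns I < opt_value Single Connected ne ns I) \<and>
     (\<forall>I :: 'v zd_instance. valid_instance I \<longrightarrow>
        tree (nodes I) (edges I) \<longrightarrow>
        (\<forall>d\<in>od_pairs I. simple_path (nodes I) (edges I) (od_path I d)) \<longrightarrow>
        opt_value Multiple Connected ne ns I = opt_value Single Connected ne ns I)"
proof -
  have "opt_value c Arbitrary ne ns line_instance < opt_value c Connected ne ns line_instance" for c
    using opt_value_line_Arbitrary[of c ne ns] opt_value_line_Connected[of c ne ns] by linarith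
  then show ?thesis
    using valid_line_instance opt_value_Arbitrary_le_Connected opt_value_Multiple_eq_Single by blast
qed

end
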